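(* Let $j \ge k$ be positive integers. The following statements hold for any digraph $D$. (1) $\vec{\lambda}_{j,k}(D)=0$ if and only if $D$ has no edge. (2) If $D$ has at least one edge, then $\vec{\lambda}_{j,k}(D) \ge j$. (3) If $D$ has at least one edge, then $\vec{\lambda}_{j,k}(D)=j$ if and only if every vertex of $D$ is either a source or a sink.
   Context: All digraphs are finite and strongly simple: they have no loops, no multiple edges, and never contain both edges $xy$ and $yx$. In a digraph $D$, $xy\in E(D)$ denotes an edge directed from $x$ to $y$, and then $x$ is adjacent to $y$. A source is a vertex $v$ with no in-neighbors (no $u$ with $uv\in E(D)$). A sink is a vertex $v$ with no out-neighbors (no $u$ with $vu\in E(D)$). An isolated vertex is both. The distance $d_D(x,y)$ is the length of a shortest dipath (directed path) from $x$ to $y$ (if one exists). For positive integers $j\ge k$, an $L(j,k)$-labeling of $D$ is a function $f$ from $V(D)$ to the nonnegative integers such that $|f(x)-f(y)|\ge j$ whenever $xy\in E(D)$ and $|f(x)-f(y)|\ge k$ whenever $d_D(x,y)=2$. The number $\vec{\lambda}_{j,k}(D)$ is the minimum, over all $L(j,k)$-labelings $f$ of $D$, of the span of $f$ (largest label minus smallest label). Equivalently, it is the minimum over all $L(j,k)$-labelings of the maximum label used. *)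

theory Defs
  imports "Graph_Theory.Arc_Walk" "HOL-Library.Extended_Nat"
begin

locale strongly_simple_digraph = digraph +
  assumes no_opposite_arcs: "u \<rightarrow>\<^bsub>G\<^esub> v \<Longrightarrow> \<not> v \<rightarrow>\<^bsub>G\<^esub> u"

definition is_source :: "('a, 'b) pre_digraph \<Rightarrow> 'a \<Rightarrow> bool" where
  "is_source G v \<longleftrightarrow> v \<in> verts G \<and> \<not> (\<exists>u. u \<rightarrow>\<^bsub>G\<^esub> v)"

definition is_sink :: "('a, 'b) pre_digraph \<Rightarrow> 'a \<Rightarrow> bool" where
  "is_sink G v \<longleftrightarrow> v \<in> verts G \<and> \<not> (\<exists>u. v \<rightarrow>\<^bsub>G\<^esub> u)"

text \<open>The distance is \<open>\<infinity>\<close> if there is no dipath from \<open>x\<close> to \<open>y\<close>.\<close>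

definition dipath_dist :: "('a, 'b) pre_digraph \<Rightarrow> 'a \<Rightarrow> 'a \<Rightarrow> enat" where
  "dipath_dist G x y = (INF p \<in> {p. pre_digraph.apath G x p y}. enat (length p))"

text \<open>
  Labels are natural numbers; the differences are taken in \<open>int\<close> because subtraction
  on \<open>nat\<close> truncates. Values of \<open>f\<close> outside of \<open>verts G\<close> are irrelevant.
\<close>

definition L_labeling :: "nat \<Rightarrow> nat \<Rightarrow> ('a, 'b) pre_digraph \<Rightarrow> ('a \<Rightarrow> nat) \<Rightarrow> bool" where
  "L_labeling j k G f \<longleftrightarrow>
     (\<forall>x \<in> verts G. \<forall>y \<in> verts G.
        (x \<rightarrow>\<^bsub>G\<^esub> y \<longrightarrow> \<bar>int (f x) - int (f y)\<bar> \<ge> int j) \<and>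
        (dipath_dist G x y = 2 \<longrightarrow> \<bar>int (f x) - int (f y)\<bar> \<ge> int k))"

text \<open>The digraph without vertices is allowed; its labelings have span \<open>0\<close>.\<close>

definition label_span :: "('a, 'b) pre_digraph \<Rightarrow> ('a \<Rightarrow> nat) \<Rightarrow> nat" where
  "label_span G f =
     (if verts G = {} then 0 else Max (f ` verts G) - Min (f ` verts G))"

definition lambda_number :: "nat \<Rightarrow> nat \<Rightarrow> ('a, 'b) pre_digraph \<Rightarrow> nat" where
  "lambda_number j k G = (LEAST s. \<exists>f. L_labeling j k G f \<and> label_span G f = s)"

text \<open>The minimum is attained, since every such digraph has a labeling.\<close>

lemma dipath_dist_self:
  assumes "x \<in> verts G"
  shows "dipath_dist G x x = 0"
proof -
  have "pre_digraph.apath G x [] x"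
    using assms by (simp add: pre_digraph.apath_def pre_digraph.awalk_def
        pre_digraph.awalk_verts.simps pre_digraph.cas.simps)
  then have "dipath_dist G x x \<le> 0"
    unfolding dipath_dist_def by (intro INF_lower2[of "[]"]) (simp_all add: zero_enat_def)
  then show ?thesis by simp
qed

lemma (in strongly_simple_digraph) lambda_number_attained:
  assumes "k \<le> j"
  shows "\<exists>f. L_labeling j k G f \<and> label_span G f = lambda_number j k G"
proof -
  obtain h :: "'a \<Rightarrow> nat" where h: "inj_on h (verts G)"
    using finite_imp_inj_to_nat_seg[OF finite_verts] by blast
  have far: "\<bar>int (j * h x) - int (j * h y)\<bar> \<ge> int j"
    if "x \<in> verts G" "y \<in> verts G" "x \<noteq> y" for x y
  proof -
    have "h x \<noteq> h y" using inj_onD[OF h] that by blast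
    then have ge1: "1 \<le> \<bar>int (h x) - int (h y)\<bar>" by linarith
    have "int (j * h x) - int (j * h y) = int j * (int (h x) - int (h y))"
      by (simp only: of_nat_mult right_diff_distrib)
    then have "\<bar>int (j * h x) - int (j * h y)\<bar> = int j * \<bar>int (h x) - int (h y)\<bar>"
      by (simp only: abs_mult abs_of_nat)
    then show ?thesis using mult_left_mono[OF ge1, of "int j"] by (simp only: mult_1_right of_nat_0_le_iff)
  qed
  have "L_labeling j k G (\<lambda>x. j * h x)"
    unfolding L_labeling_def
  proof (intro ballI conjI impI)
    fix x y assume xy: "x \<in> verts G" "y \<in> verts G"
    show "int j \<le> \<bar>int (j * h x) - int (j * h y)\<bar>" if "x \<rightarrow> y"
    proof -
      have "x \<noteq> y" using that adj_not_same by metis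
      then show ?thesis by (rule far[OF xy])
    qed
    show "int k \<le> \<bar>int (j * h x) - int (j * h y)\<bar>" if "dipath_dist G x y = 2"
    proof -
      have "x \<noteq> y" using that dipath_dist_self[OF xy(1)] by force
      then have "int j \<le> \<bar>int (j * h x) - int (j * h y)\<bar>" by (rule far[OF xy])
      moreover have "int k \<le> int j" using assms by simp
      ultimately show ?thesis by (rule order_trans[rotated])
    qed
  qed
  then show ?thesis
    unfolding lambda_number_def
    using LeastI_ex[of "\<lambda>s. \<exists>f. L_labeling j k G f \<and> label_span G f = s"] by blast
qed

end

theory Submission
  imports Defs
begin

text \<open>
  An edge forces two labels at distance at least \<open>j\<close>, so a digraph with an edge has span at
  least \<open>j\<close>, and a digraph without edges may be labelled constantly. This leaves the question of
  when span exactly \<open>j\<close> can be reached.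

  If all labels lie in an interval of length \<open>j\<close>, then the two ends of an edge carry the two
  endpoints of that interval. Along \<open>u \<rightarrow> v \<rightarrow> w\<close> the labels therefore alternate, and \<open>u\<close> and
  \<open>w\<close> get the same label. But \<open>u\<close> and \<open>w\<close> are distinct, as opposite edges are excluded, so they
  are either joined by the edge \<open>u \<rightarrow> w\<close> or at distance \<open>2\<close>; both need different labels, because
  \<open>j \<ge> k > 0\<close>. Hence no vertex has both an in-neighbour and an out-neighbour. Conversely, if every
  vertex is a source or a sink, no dipath has length \<open>2\<close>, the condition on distance \<open>2\<close> is void,
  and the labels \<open>0\<close> on sinks and \<open>j\<close> elsewhere satisfy the condition on edges.
\<close>

section \<open>Vertices at distance two\<close>

text \<open>
  The infimum of a nonempty set in \<open>enat\<close> is attained, so a finite distance is the length of an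
  actual dipath.
\<close>

lemma (in wf_digraph) dipath_dist_2D:
  assumes "dipath_dist G x y = 2"
  obtains m where "x \<rightarrow> m" "m \<rightarrow> y"
proof -
  let ?L = "(\<lambda>p. enat (length p)) ` {p. apath x p y}"
  have "?L \<noteq> {}"
  proof
    assume "?L = {}"
    then have "dipath_dist G x y = \<infinity>"
      unfolding dipath_dist_def by (simp only: Inf_empty top_enat_def)
    with assms show False by simp
  qed
  then have "Inf ?L \<in> ?L"
    unfolding Inf_enat_def by (auto intro: LeastI)
  then obtain p where p: "apath x p y" "enat (length p) = 2"
    using assms unfolding dipath_dist_def by auto
  from p(2) have "length p = 2"
    by (metis enat.inject numeral_eq_enat)
  then obtain e e' where "p = [e, e']"
    by (auto simp: length_Suc_conv numeral_2_eq_2)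
  with p(1) have "e \<in> arcs G" "tail G e = x" "e' \<in> arcs G" "tail G e' = head G e" "head G e' = y"
    by (auto simp: apath_def awalk_simps)
  then have "x \<rightarrow> head G e" "head G e \<rightarrow> y"
    by (metis in_arcs_imp_in_arcs_ends)+
  then show thesis by (rule that)
qed

lemma (in loopfree_digraph) dipath_dist_2I:
  assumes "x \<rightarrow> m" "m \<rightarrow> y" "x \<noteq> y" "\<not> x \<rightarrow> y"
  shows "dipath_dist G x y = 2"
proof (rule antisym)
  obtain e e' where e: "e \<in> arcs G" "tail G e = x" "head G e = m"
    "e' \<in> arcs G" "tail G e' = m" "head G e' = y"
    using assms(1,2) by (auto simp: arcs_ends_def arc_to_ends_def)
  have "x \<noteq> m" "m \<noteq> y"
    using assms(1,2) adj_not_same by blast+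
  then have "apath x [e, e'] y"
    using e assms(3) by (auto simp: apath_def awalk_simps)
  then show "dipath_dist G x y \<le> 2"
    unfolding dipath_dist_def
    by (intro INF_lower2[of "[e, e']"]) (simp_all add: numeral_eq_enat)
next
  have "2 \<le> length p" if p: "apath x p y" for p
  proof (rule ccontr)
    assume "\<not> 2 \<le> length p"
    then consider "p = []" | e where "p = [e]"
      by (cases p; cases "tl p") auto
    then show False
    proof cases
      case 1
      with p assms(3) show False by (auto simp: apath_def awalk_simps)
    next
      case 2
      with p have "e \<in> arcs G" "tail G e = x" "head G e = y"
        by (auto simp: apath_def awalk_simps)
      then have "x \<rightarrow> y" by (metis in_arcs_imp_in_arcs_ends)
      with assms(4) show False by blast
    qed
  qed
  then show "2 \<le> dipath_dist G x y"
    unfolding dipath_dist_def by (intro INF_greatest) (simp add: numeral_eq_enat)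
qed

section \<open>Spans of labelings\<close>

lemma (in fin_digraph) label_diff_le_span:
  assumes "x \<in> verts G" "y \<in> verts G"
  shows "\<bar>int (f x) - int (f y)\<bar> \<le> int (label_span G f)"
proof -
  have "Min (f ` verts G) \<le> f z \<and> f z \<le> Max (f ` verts G)" if "z \<in> verts G" for z
    using that by simp
  from this[OF assms(1)] this[OF assms(2)]
  have "\<bar>int (f x) - int (f y)\<bar> \<le> int (Max (f ` verts G) - Min (f ` verts G))"
    by linarith
  moreover have "label_span G f = Max (f ` verts G) - Min (f ` verts G)"
    using assms(1) by (auto simp: label_span_def)
  ultimately show ?thesis by (simp only:)
qed

lemma (in fin_digraph) label_span_le:
  assumes "\<And>v. v \<in> verts G \<Longrightarrow> f v \<le> s"
  shows "label_span G f \<le> s"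
proof (cases "verts G = {}")
  case True
  then show ?thesis by (simp add: label_span_def)
next
  case False
  then have "Max (f ` verts G) \<le> s" using assms by simp
  then have "Max (f ` verts G) - Min (f ` verts G) \<le> s" by (rule le_trans[OF diff_le_self])
  with False show ?thesis by (simp add: label_span_def)
qed

lemma lambda_number_le:
  assumes "L_labeling j k G f"
  shows "lambda_number j k G \<le> label_span G f"
  unfolding lambda_number_def using assms by (intro Least_le) blast

lemma (in wf_digraph) L_labeling_adjD:
  assumes "L_labeling j k G f" "x \<rightarrow> y"
  shows "int j \<le> \<bar>int (f x) - int (f y)\<bar>"
  using assms adj_in_verts[OF assms(2)] by (auto simp: L_labeling_def)

lemma (in wf_digraph) arcs_nonempty_iff_adj: "arcs G \<noteq> {} \<longleftrightarrow> (\<exists>x y. x \<rightarrow> y)"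
  by (auto simp: arcs_ends_def arc_to_ends_def)

section \<open>Digraphs of small span\<close>

lemma (in strongly_simple_digraph) lambda_number_ge:
  assumes "k \<le> j" "arcs G \<noteq> {}"
  shows "j \<le> lambda_number j k G"
proof -
  obtain f where f: "L_labeling j k G f" "label_span G f = lambda_number j k G"
    using lambda_number_attained[OF assms(1)] by blast
  obtain x y where xy: "x \<rightarrow> y"
    using assms(2) arcs_nonempty_iff_adj by blast
  show ?thesis
    using L_labeling_adjD[OF f(1) xy] label_diff_le_span[OF adj_in_verts[OF xy], of f] f(2)
    by linarith
qed

text \<open>
  Sinks get the label \<open>0\<close> and all other vertices the label \<open>b\<close>. Taking \<open>b = j\<close> satisfies
  the condition on edges; in a digraph without edges \<open>b = 0\<close> is enough, which is why \<open>b\<close> is left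
  free. No two vertices are at distance \<open>2\<close>, since an inner vertex of a dipath is neither a
  source nor a sink.
\<close>

lemma (in fin_digraph) lambda_number_le_if_sources_sinks:
  assumes "\<forall>v \<in> verts G. is_source G v \<or> is_sink G v" "arcs G = {} \<or> j \<le> b"
  shows "lambda_number j k G \<le> b"
proof -
  define f where "f v = (if is_sink G v then 0 else b)" for v
  have "L_labeling j k G f"
    unfolding L_labeling_def
  proof (intro ballI conjI impI)
    fix x y
    show "int j \<le> \<bar>int (f x) - int (f y)\<bar>" if "x \<rightarrow> y"
    proof -
      have "\<not> is_sink G x" "\<not> is_source G y"
        using that by (auto simp: is_sink_def is_source_def)
      then have "f x = b" "f y = 0"
        using assms(1) adj_in_verts[OF that] by (auto simp: f_def)
      moreover have "j \<le> b"
        using assms(2) that arcs_nonempty_iff_adj by blast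
      ultimately show ?thesis by simp
    qed
    show "int k \<le> \<bar>int (f x) - int (f y)\<bar>" if dist: "dipath_dist G x y = 2"
    proof -
      obtain m where m: "x \<rightarrow> m" "m \<rightarrow> y" using dist by (rule dipath_dist_2D)
      then have "\<not> is_source G m" "\<not> is_sink G m"
        by (auto simp: is_source_def is_sink_def)
      with assms(1) adj_in_verts[OF m(1)] show ?thesis by blast
    qed
  qed
  then have "lambda_number j k G \<le> label_span G f" by (rule lambda_number_le)
  also have "\<dots> \<le> b" by (rule label_span_le) (simp add: f_def)
  finally show ?thesis .
qed

text \<open>
  With span \<open>j\<close>, the middle vertex of \<open>u \<rightarrow> v \<rightarrow> w\<close> sits at one end of the range of labels and
  both outer vertices at the other end, so that the label of \<open>u\<close> is repeated at \<open>w\<close>.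
\<close>

lemma (in strongly_simple_digraph) source_or_sink_if_span_le:
  assumes "0 < k" "k \<le> j" and f: "L_labeling j k G f" "label_span G f \<le> j"
    and v: "v \<in> verts G"
  shows "is_source G v \<or> is_sink G v"
proof (rule ccontr)
  assume "\<not> (is_source G v \<or> is_sink G v)"
  then obtain u w where uv: "u \<rightarrow> v" and vw: "v \<rightarrow> w"
    using v by (auto simp: is_source_def is_sink_def)
  have verts: "u \<in> verts G" "w \<in> verts G"
    using adj_in_verts uv vw by blast+
  \<comment> \<open>The bound on the outer pair excludes that \<open>f v\<close> lies midway between \<open>f u\<close> and \<open>f w\<close>.\<close>
  have eq: "f u = f w"
    using L_labeling_adjD[OF f(1) uv] L_labeling_adjD[OF f(1) vw] f(2) assms(1,2)
      label_diff_le_span[OF verts(1) v, of f] label_diff_le_span[OF v verts(2), of f]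
      label_diff_le_span[OF verts, of f]
    by linarith
  have "u \<noteq> w" using no_opposite_arcs uv vw by blast
  show False
  proof (cases "u \<rightarrow> w")
    case True
    from L_labeling_adjD[OF f(1) True] eq assms(1,2) show False by simp
  next
    case False
    with uv vw \<open>u \<noteq> w\<close> have "dipath_dist G u w = 2" by (intro dipath_dist_2I)
    with f(1) verts have "int k \<le> \<bar>int (f u) - int (f w)\<bar>" by (auto simp: L_labeling_def)
    with eq assms(1) show False by simp
  qed
qed

theorem lemma4:
  fixes D :: "('a, 'b) pre_digraph" and j k :: nat
  assumes "strongly_simple_digraph D"
    and "k > 0" and "j \<ge> k"
  shows "(lambda_number j k D = 0 \<longleftrightarrow> arcs D = {}) \<and>
    (arcs D \<noteq> {} \<longrightarrow> lambda_number j k D \<ge> j) \<and>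
    (arcs D \<noteq> {} \<longrightarrow>
      (lambda_number j k D = j \<longleftrightarrow> (\<forall>v \<in> verts D. is_source D v \<or> is_sink D v)))"
proof -
  interpret strongly_simple_digraph D by fact
  have ge: "j \<le> lambda_number j k D" if "arcs D \<noteq> {}"
    using lambda_number_ge assms(3) that .
  have edgeless: "lambda_number j k D = 0" if "arcs D = {}"
  proof -
    have "\<forall>v \<in> verts D. is_source D v \<or> is_sink D v"
      using that by (auto simp: is_source_def arcs_ends_def)
    then show ?thesis
      using lambda_number_le_if_sources_sinks[of j 0 k] that by simp
  qed
  have "lambda_number j k D = j \<longleftrightarrow> (\<forall>v \<in> verts D. is_source D v \<or> is_sink D v)"
    if "arcs D \<noteq> {}"
  proof
    assume "lambda_number j k D = j"
    then obtain f where "L_labeling j k D f" "label_span D f = j"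
      using lambda_number_attained[OF assms(3)] by auto
    then show "\<forall>v \<in> verts D. is_source D v \<or> is_sink D v"
      using source_or_sink_if_span_le[OF assms(2,3)] by blast
  next
    assume "\<forall>v \<in> verts D. is_source D v \<or> is_sink D v"
    then show "lambda_number j k D = j"
      using lambda_number_le_if_sources_sinks[of j j k] ge[OF that] by simp
  qed
  moreover have "lambda_number j k D = 0 \<longleftrightarrow> arcs D = {}"
    using edgeless ge assms(2,3) by fastforce
  ultimately show ?thesis using ge by blast
qed

end
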